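(* Let $Q(f)=\sum_{j=1}^{N}w_jf(\mathbf{x}_j)$ be a quadrature formula on $\mathbb{S}^2$, let $n\in\mathbb{N}_0$, and let $L_n:=L_{n,Q}$ denote the associated degree-$n$ hyperinterpolation operator. Then, for any fixed constant $C>0$, the $L^1$--$L^2$ Marcinkiewicz--Zygmund condition $$\sum_{j=1}^N|w_j||p(\mathbf{x}_j)|\leq C\|p\|_{L^2(\mathbb{S}^2)}\quad\text{for all } p\in\mathbb{P}_n(\mathbb{S}^2)$$ holds if and only if $$\|L_n\|_{C(\mathbb{S}^2)\to L^2(\mathbb{S}^2)}\leq C.$$
   Context: $\mathbb{S}^2=\{\mathbf{x}\in\mathbb{R}^3:\|\mathbf{x}\|_2=1\}$ carries the surface measure $\omega$ with $\omega(\mathbb{S}^2)=4\pi$; $C(\mathbb{S}^2)$ is the space of real-valued continuous functions with the uniform norm $\|\cdot\|_\infty$; $L^2(\mathbb{S}^2)$ is taken with respect to $\omega$. $\mathbb{N}_0=\{0,1,2,\ldots\}$. $\mathbb{H}_\ell$ is the space of spherical harmonics of degree $\ell$ (restrictions to $\mathbb{S}^2$ of real harmonic homogeneous polynomials of degree $\ell$ on $\mathbb{R}^3$), $\{Y_{\ell,k}: |k|\le \ell\}$ is an $L^2(\mathbb{S}^2)$-orthonormal basis of $\mathbb{H}_\ell$, and $\mathbb{P}_n(\mathbb{S}^2)=\bigoplus_{\ell=0}^n\mathbb{H}_\ell$. A quadrature formula is a linear functional $Q(f)=\sum_{j=1}^N w_jf(\mathbf{x}_j)$ on $C(\mathbb{S}^2)$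 given by $N$ pairwise distinct nodes $\mathbf{x}_1,\ldots,\mathbf{x}_N\in\mathbb{S}^2$ and arbitrary real (possibly signed) weights. The degree-$n$ hyperinterpolation operator associated with $Q$ is $L_{n,Q}:C(\mathbb{S}^2)\to\mathbb{P}_n(\mathbb{S}^2)$, $L_{n,Q}f:=\sum_{\ell=0}^n\sum_{k=-\ell}^{\ell}Q(fY_{\ell,k})\,Y_{\ell,k}$, with operator norm $\|L_{n,Q}\|_{C(\mathbb{S}^2)\to L^2(\mathbb{S}^2)}=\sup_{\|f\|_\infty\le1}\|L_{n,Q}f\|_{L^2(\mathbb{S}^2)}$. *)

theory Defs
  imports "HOL-Analysis.Analysis"
begin

text \<open>Functions on the sphere are represented by functions on all of \<open>real^3\<close>; only their
  values on \<open>S2\<close> matter, and the function spaces below are closed under changing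
  values off \<open>S2\<close>.\<close>

definition S2 :: "(real^3) set" where
  "S2 = sphere 0 1"

text \<open>Surface measure, in its polar-coordinate form: \<open>\<omega>(A)\<close> is three times the volume of the
  cone \<open>{t *\<^sub>R x | x \<in> A, 0 < t \<le> 1}\<close>.\<close>

definition surface_measure :: "(real^3) measure" where
  "surface_measure = scale_measure 3
     (distr (restrict_space lborel (cball 0 1 - {0})) (restrict_space borel S2)
        (\<lambda>x. x /\<^sub>R norm x))"

definition L2_inner :: "(real^3 \<Rightarrow> real) \<Rightarrow> (real^3 \<Rightarrow> real) \<Rightarrow> real" where
  "L2_inner f g = (\<integral>x. f x * g x \<partial>surface_measure)"

definition L2_norm :: "(real^3 \<Rightarrow> real) \<Rightarrow> real" where
  "L2_norm f = sqrt (L2_inner f f)"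

definition C_S2 :: "(real^3 \<Rightarrow> real) set" where
  "C_S2 = {f. continuous_on S2 f}"

definition sup_norm :: "(real^3 \<Rightarrow> real) \<Rightarrow> real" where
  "sup_norm f = (SUP x\<in>S2. \<bar>f x\<bar>)"

definition laplacian :: "(real^3 \<Rightarrow> real) \<Rightarrow> real^3 \<Rightarrow> real" where
  "laplacian p x = (\<Sum>i\<in>UNIV. (deriv ^^ 2) (\<lambda>t. p (x + t *\<^sub>R axis i 1)) 0)"

definition harmonic_homogeneous_poly :: "nat \<Rightarrow> (real^3 \<Rightarrow> real) \<Rightarrow> bool" where
  "harmonic_homogeneous_poly l p \<longleftrightarrow>
     real_polynomial_function p \<and>
     (\<forall>c x. p (c *\<^sub>R x) = c ^ l * p x) \<and>
     (\<forall>x. laplacian p x = 0)"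

definition spherical_harmonics :: "nat \<Rightarrow> (real^3 \<Rightarrow> real) set" where
  "spherical_harmonics l = {f. \<exists>p. harmonic_homogeneous_poly l p \<and> (\<forall>x\<in>S2. f x = p x)}"

definition orthonormal_basis_harmonics :: "nat \<Rightarrow> (int \<Rightarrow> real^3 \<Rightarrow> real) \<Rightarrow> bool" where
  "orthonormal_basis_harmonics l Y \<longleftrightarrow>
     (\<forall>k\<in>{-int l..int l}. Y k \<in> spherical_harmonics l) \<and>
     (\<forall>k\<in>{-int l..int l}. \<forall>k'\<in>{-int l..int l}. L2_inner (Y k) (Y k') = (if k = k' then 1 else 0)) \<and>
     (\<forall>f\<in>spherical_harmonics l. \<exists>c. \<forall>x\<in>S2. f x = (\<Sum>k=-int l..int l. c k * Y k x))"

definition sphere_polys :: "nat \<Rightarrow> (real^3 \<Rightarrow> real) set" where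
  "sphere_polys n = {f. \<exists>h. (\<forall>l\<le>n. h l \<in> spherical_harmonics l) \<and> (\<forall>x\<in>S2. f x = (\<Sum>l\<le>n. h l x))}"

definition quadrature_data :: "nat \<Rightarrow> (nat \<Rightarrow> real^3) \<Rightarrow> bool" where
  "quadrature_data N x \<longleftrightarrow> x ` {1..N} \<subseteq> S2 \<and> inj_on x {1..N}"

definition quadrature ::
  "nat \<Rightarrow> (nat \<Rightarrow> real) \<Rightarrow> (nat \<Rightarrow> real^3) \<Rightarrow> (real^3 \<Rightarrow> real) \<Rightarrow> real" where
  "quadrature N w x f = (\<Sum>j=1..N. w j * f (x j))"

definition hyperinterpolation ::
  "(nat \<Rightarrow> int \<Rightarrow> real^3 \<Rightarrow> real) \<Rightarrow> nat \<Rightarrow> ((real^3 \<Rightarrow> real) \<Rightarrow> real)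
     \<Rightarrow> (real^3 \<Rightarrow> real) \<Rightarrow> real^3 \<Rightarrow> real" where
  "hyperinterpolation Y n Q f =
     (\<lambda>x. \<Sum>l\<le>n. \<Sum>k=-int l..int l. Q (\<lambda>y. f y * Y l k y) * Y l k x)"

text \<open>The supremum is taken in \<open>ereal\<close>, so that it is meaningful without a prior
  boundedness proof.\<close>

definition op_norm_C_L2 :: "((real^3 \<Rightarrow> real) \<Rightarrow> real^3 \<Rightarrow> real) \<Rightarrow> ereal" where
  "op_norm_C_L2 L = (SUP f\<in>{f\<in>C_S2. sup_norm f \<le> 1}. ereal (L2_norm (L f)))"

lemma space_surface_measure: "space surface_measure = S2"
  by (simp add: surface_measure_def space_scale_measure space_restrict_space)

lemma sets_surface_measure: "sets surface_measure = sets (restrict_space borel S2)"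
  by (simp add: surface_measure_def)

lemma emeasure_surface_measure_S2: "emeasure surface_measure S2 = ennreal (4 * pi)"
proof -
  let ?B = "cball (0::real^3) 1 - {0}"
  let ?M = "restrict_space lborel ?B"
  let ?g = "\<lambda>x::real^3. x /\<^sub>R norm x"
  have "?g \<in> borel_measurable borel"
    by (intro borel_measurable_scaleR borel_measurable_inverse borel_measurable_norm) auto
  then have "?g \<in> measurable ?M borel"
    by (intro measurable_restrict_space1) simp
  then have meas: "?g \<in> measurable ?M (restrict_space borel S2)"
    by (rule measurable_restrict_space2[rotated]) (auto simp: space_restrict_space S2_def)
  have pre: "?g -` S2 \<inter> space ?M = ?B"
    by (auto simp: space_restrict_space S2_def)
  have "S2 \<in> sets (restrict_space borel S2)"
    using sets.top[of "restrict_space borel S2"] by (simp add: space_restrict_space)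
  then have "emeasure surface_measure S2 = 3 * emeasure ?M ?B"
    unfolding surface_measure_def by (simp only: emeasure_scale_measure emeasure_distr[OF meas] pre)
  also have "emeasure ?M ?B = emeasure lborel ?B"
    by (subst emeasure_restrict_space) auto
  also have "\<dots> = emeasure lborel (cball (0::real^3) 1)"
    by (rule emeasure_Diff_null_set) auto
  also have "\<dots> = ennreal (unit_ball_vol 3)"
    by (subst emeasure_cball) auto
  also have "3 * \<dots> = ennreal (4 * pi)"
    by (simp add: unit_ball_vol_3 flip: ennreal_numeral ennreal_mult)
  finally show ?thesis .
qed

end

theory Submission
  imports Defs
begin

text \<open>Rotation invariance of the surface measure makes the angular derivatives
  \<open>x\<^sub>i \<partial>\<^sub>j - x\<^sub>j \<partial>\<^sub>i\<close> antisymmetric in \<open>L\<^sup>2\<close>, and the sum of their squares acts on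
  harmonic homogeneous polynomials of degree \<open>l\<close> as \<open>-l (l + 1)\<close>. Hence spherical harmonics of
  different degrees are orthogonal, so the functions \<open>Y l k\<close> with \<open>l \<le> n\<close> are jointly orthonormal and
  \<open>\<langle>L f, p\<rangle> = Q (f p)\<close> for all \<open>p\<close> of degree at most \<open>n\<close>. Taking \<open>p = L f\<close> bounds \<open>\<parallel>L f\<parallel>\<close> by the
  Marcinkiewicz--Zygmund condition; conversely, a continuous \<open>f\<close> of norm at most 1 with
  \<open>f (x\<^sub>j) = sgn (w\<^sub>j p (x\<^sub>j))\<close> turns \<open>Q (f p)\<close> into \<open>\<Sum> \<bar>w\<^sub>j\<bar> \<bar>p (x\<^sub>j)\<bar>\<close>, and Cauchy--Schwarz applies.\<close>

subsection \<open>Partial and angular derivatives of polynomials\<close>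

text \<open>Built on the Frechet derivative so that the sum and product rules for
  \<open>has_derivative\<close> carry over directly; \<open>laplacian_eq_sum_partial_deriv\<close>
  connects it with the iterated \<open>deriv\<close> in \<open>laplacian\<close>.\<close>

definition partial_deriv :: "'n \<Rightarrow> (real^'n \<Rightarrow> real) \<Rightarrow> real^'n \<Rightarrow> real" where
  "partial_deriv i p x = frechet_derivative p (at x) (axis i 1)"

lemma partial_deriv_eqI:
  assumes "(p has_derivative D) (at x)"
  shows "partial_deriv i p x = D (axis i 1)"
  using frechet_derivative_at[OF assms] by (simp add: partial_deriv_def)

lemma has_derivative_partial_deriv:
  fixes p :: "real^'n \<Rightarrow> real"
  assumes "p differentiable at x"
  shows "(p has_derivative (\<lambda>h. \<Sum>i\<in>UNIV. h $ i * partial_deriv i p x)) (at x)"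
proof -
  let ?D = "frechet_derivative p (at x)"
  have D: "(p has_derivative ?D) (at x)"
    using assms by (simp add: frechet_derivative_works)
  then interpret bounded_linear ?D by (rule has_derivative_bounded_linear)
  have "?D = (\<lambda>h. \<Sum>i\<in>UNIV. h $ i * partial_deriv i p x)"
  proof
    fix h
    have "?D h = ?D (\<Sum>i\<in>UNIV. h $ i *\<^sub>R axis i 1)"
      by (subst basis_expansion[of h, symmetric]) (simp add: scalar_mult_eq_scaleR)
    then show "?D h = (\<Sum>i\<in>UNIV. h $ i * partial_deriv i p x)"
      by (simp add: sum scaleR partial_deriv_def)
  qed
  with D show ?thesis by simp
qed

lemma partial_deriv_add:
  assumes "p differentiable at x" "q differentiable at x"
  shows "partial_deriv i (\<lambda>x. p x + q x) x = partial_deriv i p x + partial_deriv i q x"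
  using assms unfolding frechet_derivative_works
  by (subst partial_deriv_eqI) (auto intro: has_derivative_add simp: partial_deriv_def)

lemma partial_deriv_diff:
  assumes "p differentiable at x" "q differentiable at x"
  shows "partial_deriv i (\<lambda>x. p x - q x) x = partial_deriv i p x - partial_deriv i q x"
  using assms unfolding frechet_derivative_works
  by (subst partial_deriv_eqI) (auto intro: has_derivative_diff simp: partial_deriv_def)

lemma partial_deriv_mult:
  assumes "p differentiable at x" "q differentiable at x"
  shows "partial_deriv i (\<lambda>x. p x * q x) x = p x * partial_deriv i q x + partial_deriv i p x * q x"
  using assms unfolding frechet_derivative_works
  by (subst partial_deriv_eqI) (auto intro: has_derivative_mult simp: partial_deriv_def)

lemma partial_deriv_const [simp]: "partial_deriv i (\<lambda>x. c) = (\<lambda>x. 0)"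
  by (rule ext, subst partial_deriv_eqI) (auto intro: has_derivative_const)

lemma partial_deriv_component [simp]:
  "partial_deriv i (\<lambda>x. x $ j) x = (if i = j then 1 else 0)"
  by (subst partial_deriv_eqI[OF bounded_linear_imp_has_derivative]) (auto simp: axis_def bounded_linear_vec_nth)

lemma real_polynomial_function_component [intro]: "real_polynomial_function (\<lambda>x::real^'n. x $ i)"
  by (simp add: bounded_linear_vec_nth real_polynomial_function.intros(1))

lemma real_polynomial_function_partial_deriv [intro]:
  fixes p :: "real^'n \<Rightarrow> real"
  assumes "real_polynomial_function p"
  shows "real_polynomial_function (partial_deriv i p)"
  using assms
proof induction
  case (linear f)
  then have "partial_deriv i f = (\<lambda>x. f (axis i 1))"
    by (intro ext partial_deriv_eqI bounded_linear_imp_has_derivative)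
  then show ?case by (simp add: real_polynomial_function.intros(2))
next
  case (const c)
  show ?case by (simp add: real_polynomial_function.intros(2))
next
  case (add f g)
  then have "partial_deriv i (\<lambda>x. f x + g x) = (\<lambda>x. partial_deriv i f x + partial_deriv i g x)"
    by (intro ext partial_deriv_add differentiable_at_real_polynomial_function)
  with add show ?case by (simp add: real_polynomial_function.intros(3))
next
  case (mult f g)
  then have "partial_deriv i (\<lambda>x. f x * g x) = (\<lambda>x. f x * partial_deriv i g x + partial_deriv i f x * g x)"
    by (intro ext partial_deriv_mult differentiable_at_real_polynomial_function)
  with mult show ?case by (simp add: real_polynomial_function.intros(3) real_polynomial_function.intros(4))
qed

text \<open>The chain rule, used with three curves: coordinate lines for the Laplacian, the ray
  through a point for Euler's identity, and circular orbits for the angular derivatives.\<close>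

lemma has_real_derivative_along_curve:
  fixes p :: "real^'n \<Rightarrow> real"
  assumes "real_polynomial_function p" and "(\<gamma> has_vector_derivative v) (at t)"
  shows "((\<lambda>t. p (\<gamma> t)) has_real_derivative (\<Sum>i\<in>UNIV. v $ i * partial_deriv i p (\<gamma> t))) (at t)"
proof -
  have "p differentiable at (\<gamma> t)"
    using assms(1) by (rule differentiable_at_real_polynomial_function)
  from has_derivative_compose[OF assms(2)[unfolded has_vector_derivative_def] has_derivative_partial_deriv[OF this]]
  have "((\<lambda>t. p (\<gamma> t)) has_derivative (\<lambda>s. \<Sum>i\<in>UNIV. (s *\<^sub>R v) $ i * partial_deriv i p (\<gamma> t))) (at t)" .
  then show ?thesis
    by (rule has_derivative_imp_has_field_derivative) (simp add: sum_distrib_left mult_ac fun_eq_iff)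
qed

lemma laplacian_eq_sum_partial_deriv:
  assumes p: "real_polynomial_function p"
  shows "laplacian p x = (\<Sum>i\<in>UNIV. partial_deriv i (partial_deriv i p) x)"
proof -
  \<comment> \<open>An equality of functions of \<open>t\<close>, for every polynomial
    \<open>q\<close>: the second derivative needs it for \<open>p\<close> and then for
    \<open>partial_deriv i p\<close>.\<close>
  have D: "deriv (\<lambda>t. q (x + t *\<^sub>R axis i 1)) = (\<lambda>t. partial_deriv i q (x + t *\<^sub>R axis i 1))"
    if q: "real_polynomial_function q" for q and i :: 3
  proof
    fix t
    have "((\<lambda>t. x + t *\<^sub>R axis i (1::real)) has_vector_derivative axis i 1) (at t)"
      by (auto intro!: derivative_eq_intros)
    from DERIV_imp_deriv[OF has_real_derivative_along_curve[OF q this]]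
    show "deriv (\<lambda>t. q (x + t *\<^sub>R axis i 1)) t = partial_deriv i q (x + t *\<^sub>R axis i 1)"
      by (simp add: axis_def if_distrib[of "\<lambda>x. x * _"] cong: if_cong)
  qed
  show ?thesis
    unfolding laplacian_def using p
    by (simp add: numeral_2_eq_2 D real_polynomial_function_partial_deriv)
qed

text \<open>Differentiate \<open>p (t *\<^sub>R x) = t ^ l * p x\<close> at \<open>t = 1\<close>,
  once by the chain rule and once directly.\<close>

lemma euler_identity:
  assumes p: "real_polynomial_function p" and hom: "\<And>c x. p (c *\<^sub>R x) = c ^ l * p x"
  shows "(\<Sum>i\<in>UNIV. x $ i * partial_deriv i p x) = real l * p x"
proof -
  have "((\<lambda>t. t *\<^sub>R x) has_vector_derivative x) (at 1)"
    by (auto intro!: derivative_eq_intros)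
  from has_real_derivative_along_curve[OF p this]
  have "((\<lambda>t. t ^ l * p x) has_real_derivative (\<Sum>i\<in>UNIV. x $ i * partial_deriv i p x)) (at 1)"
    by (simp add: hom)
  moreover have "((\<lambda>t. t ^ l * p x) has_real_derivative real l * p x) (at 1)"
    by (auto intro!: derivative_eq_intros)
  ultimately show ?thesis by (rule DERIV_unique)
qed

section \<open>Angular derivatives and their sum of squares\<close>

definition angular_deriv :: "'n \<Rightarrow> 'n \<Rightarrow> (real^'n \<Rightarrow> real) \<Rightarrow> real^'n \<Rightarrow> real" where
  "angular_deriv i j p x = x $ i * partial_deriv j p x - x $ j * partial_deriv i p x"

lemma real_polynomial_function_angular_deriv [intro]:
  assumes "real_polynomial_function p"
  shows "real_polynomial_function (angular_deriv i j p)"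
  unfolding angular_deriv_def[abs_def] using assms
  by (intro real_polynomial_function_diff real_polynomial_function.intros(4)) auto

lemma angular_deriv_mult:
  assumes "real_polynomial_function p" "real_polynomial_function q"
  shows "angular_deriv i j (\<lambda>x. p x * q x) x = angular_deriv i j p x * q x + p x * angular_deriv i j q x"
  using assms
  by (simp add: angular_deriv_def partial_deriv_mult differentiable_at_real_polynomial_function algebra_simps)

text \<open>The first-order terms arise when the outer derivative hits the coefficients
  \<open>x $ i\<close> and \<open>x $ j\<close>. The mixed partials are kept in both orders because
  both enter the Hessian quadratic form in \<open>angular_deriv_casimir\<close>.\<close>

lemma angular_deriv_twice:
  assumes p: "real_polynomial_function p" and "i \<noteq> j"
  shows "angular_deriv i j (angular_deriv i j p) x =
     (x $ i)\<^sup>2 * partial_deriv j (partial_deriv j p) x + (x $ j)\<^sup>2 * partial_deriv i (partial_deriv i p) x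
     - x $ i * x $ j * (partial_deriv i (partial_deriv j p) x + partial_deriv j (partial_deriv i p) x)
     - x $ i * partial_deriv i p x - x $ j * partial_deriv j p x"
proof -
  have d: "(\<lambda>x. x $ k) differentiable at x" "partial_deriv k p differentiable at x"
    "(\<lambda>x. x $ k * partial_deriv m p x) differentiable at x" for k m
    using p by (auto intro!: differentiable_at_real_polynomial_function real_polynomial_function.intros(4))
  have D: "partial_deriv k (angular_deriv i j p) x =
     (x $ i * partial_deriv k (partial_deriv j p) x + (if k = i then 1 else 0) * partial_deriv j p x)
     - (x $ j * partial_deriv k (partial_deriv i p) x + (if k = j then 1 else 0) * partial_deriv i p x)" for k
    unfolding angular_deriv_def[abs_def] using d by (simp add: partial_deriv_diff partial_deriv_mult)
  show ?thesis
    unfolding angular_deriv_def[of i j "angular_deriv i j p"] D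
    using \<open>i \<noteq> j\<close> by (simp add: algebra_simps power2_eq_square)
qed

text \<open>On the sphere, the sum of the squared angular derivatives is the Laplace--Beltrami operator;
  this is its eigenvalue equation.\<close>

lemma angular_deriv_casimir:
  assumes "harmonic_homogeneous_poly l p"
  shows "angular_deriv 1 2 (angular_deriv 1 2 p) x + angular_deriv 1 3 (angular_deriv 1 3 p) x
     + angular_deriv 2 3 (angular_deriv 2 3 p) x = - (real l * (real l + 1)) * p x"
proof -
  have p: "real_polynomial_function p" and hom: "\<And>c x. p (c *\<^sub>R x) = c ^ l * p x"
    and "laplacian p x = 0"
    using assms by (auto simp: harmonic_homogeneous_poly_def)
  \<comment> \<open>Gradient and Hessian at the fixed point \<open>x\<close>; the claim becomes an
    algebraic identity in these numbers.\<close>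
  define g where "g i = partial_deriv i p x" for i
  define H where "H i j = partial_deriv i (partial_deriv j p) x" for i j
  have d: "(\<lambda>x. x $ k) differentiable at x" "partial_deriv k p differentiable at x" "p differentiable at x"
    "(\<lambda>x. x $ k * partial_deriv m p x) differentiable at x" for k m
    using p by (auto intro!: differentiable_at_real_polynomial_function real_polynomial_function.intros(4))
  have dd: "(\<lambda>x. x $ k * partial_deriv m p x + x $ k' * partial_deriv m' p x) differentiable at x" for k m k' m'
    using p by (intro differentiable_at_real_polynomial_function real_polynomial_function.intros(3) real_polynomial_function.intros(4)) auto
  \<comment> \<open>Stated for functions, not only at the given point, so that it can be
    differentiated once more in \<open>EH\<close>.\<close>
  have euler: "(\<lambda>x. x $ 1 * partial_deriv 1 p x + x $ 2 * partial_deriv 2 p x + x $ 3 * partial_deriv 3 p x)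
      = (\<lambda>x. real l * p x)"
    using euler_identity[OF p hom] by (auto simp: sum_3)
  have E: "x $ 1 * g 1 + x $ 2 * g 2 + x $ 3 * g 3 = real l * p x"
    using fun_cong[OF euler, of x] by (simp add: g_def)
  \<comment> \<open>Differentiating Euler's identity in direction \<open>j\<close>: the gradient is
    homogeneous of degree \<open>l - 1\<close>. The summand with index \<open>j\<close> contributes
    the extra \<open>g j\<close>.\<close>
  have EH: "x $ 1 * H j 1 + x $ 2 * H j 2 + x $ 3 * H j 3 = (real l - 1) * g j" for j
  proof -
    have "partial_deriv j (\<lambda>x. x $ 1 * partial_deriv 1 p x + x $ 2 * partial_deriv 2 p x + x $ 3 * partial_deriv 3 p x) x
      = partial_deriv j (\<lambda>x. real l * p x) x"
      by (simp only: euler)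
    moreover have "partial_deriv j (\<lambda>x. real l * p x) x = real l * g j"
      using d by (simp add: partial_deriv_mult g_def)
    moreover have "partial_deriv j (\<lambda>x. x $ 1 * partial_deriv 1 p x + x $ 2 * partial_deriv 2 p x + x $ 3 * partial_deriv 3 p x) x
      = x $ 1 * H j 1 + x $ 2 * H j 2 + x $ 3 * H j 3 + g j"
      using d dd exhaust_3[of j] by (auto simp: partial_deriv_add partial_deriv_mult g_def H_def)
    ultimately show ?thesis by (simp add: algebra_simps)
  qed
  have L: "H 1 1 + H 2 2 + H 3 3 = 0"
    using \<open>laplacian p x = 0\<close> p by (simp add: laplacian_eq_sum_partial_deriv sum_3 H_def)
  \<comment> \<open>With H the Hessian, the sum of squares is |x|^2 times the Laplacian, minus the
    quadratic form of H at x, minus twice the radial term (each index lies in two of the three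
    planes). By \<open>L\<close> the first part vanishes, by \<open>EH\<close> and \<open>E\<close>
    the rest is -(l - 1) l p - 2 l p.\<close>
  have "angular_deriv 1 2 (angular_deriv 1 2 p) x + angular_deriv 1 3 (angular_deriv 1 3 p) x
     + angular_deriv 2 3 (angular_deriv 2 3 p) x
    = ((x$1)\<^sup>2 + (x$2)\<^sup>2 + (x$3)\<^sup>2) * (H 1 1 + H 2 2 + H 3 3)
     - (x $ 1 * (x $ 1 * H 1 1 + x $ 2 * H 1 2 + x $ 3 * H 1 3)
      + x $ 2 * (x $ 1 * H 2 1 + x $ 2 * H 2 2 + x $ 3 * H 2 3)
      + x $ 3 * (x $ 1 * H 3 1 + x $ 2 * H 3 2 + x $ 3 * H 3 3))
     - 2 * (x $ 1 * g 1 + x $ 2 * g 2 + x $ 3 * g 3)"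
    using p by (simp add: angular_deriv_twice flip: g_def H_def) (simp add: algebra_simps power2_eq_square)
  also have "\<dots> = - (real l - 1) * (x $ 1 * g 1 + x $ 2 * g 2 + x $ 3 * g 3) - 2 * (x $ 1 * g 1 + x $ 2 * g 2 + x $ 3 * g 3)"
    unfolding EH L by (simp add: algebra_simps)
  also have "\<dots> = - (real l * (real l + 1)) * p x"
    unfolding E by (simp add: algebra_simps)
  finally show ?thesis .
qed

section \<open>Rotations in a coordinate plane and their generators\<close>

definition plane_rotation :: "'n \<Rightarrow> 'n \<Rightarrow> real \<Rightarrow> real^'n \<Rightarrow> real^'n" where
  "plane_rotation i j t x =
     (\<chi> k. if k = i then cos t * x $ i - sin t * x $ j
          else if k = j then sin t * x $ i + cos t * x $ j else x $ k)"

lemma plane_rotation_0 [simp]: "plane_rotation i j 0 x = x"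
  by (simp add: plane_rotation_def vec_eq_iff)

lemma orthogonal_transformation_plane_rotation:
  assumes "i \<noteq> j"
  shows "orthogonal_transformation (plane_rotation i j t)"
  unfolding orthogonal_transformation_def
proof (intro conjI allI)
  show "linear (plane_rotation i j t)"
    by (rule linearI) (auto simp: plane_rotation_def vec_eq_iff algebra_simps)
  fix v w
  \<comment> \<open>Only the coordinates \<open>i\<close> and \<open>j\<close> move, so the inner
    product is split into these two terms and an unchanged rest.\<close>
  have split: "sum f UNIV = sum f (UNIV - {i, j}) + (f i + f j)" for f :: "_ \<Rightarrow> real"
    using assms sum.subset_diff[of "{i,j}" UNIV f] by simp
  have "(cos t * a - sin t * b) * (cos t * c - sin t * d) + (sin t * a + cos t * b) * (sin t * c + cos t * d)
      = ((sin t)\<^sup>2 + (cos t)\<^sup>2) * (a * c + b * d)" for a b c d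
    by algebra
  then show "plane_rotation i j t v \<bullet> plane_rotation i j t w = v \<bullet> w"
    using assms by (simp add: inner_vec_def split plane_rotation_def)
qed

text \<open>\<open>angular_deriv i j\<close> generates these rotations. The formula is needed at
  every angle, not just at 0, because the mean value theorem is applied along the orbit
  later.\<close>

lemma has_real_derivative_plane_rotation:
  fixes p :: "real^'n \<Rightarrow> real"
  assumes p: "real_polynomial_function p" and "i \<noteq> j"
  shows "((\<lambda>t. p (plane_rotation i j t x)) has_real_derivative
     angular_deriv i j p (plane_rotation i j t x)) (at t)"
proof -
  let ?R = "\<lambda>t. plane_rotation i j t x"
  \<comment> \<open>The velocity is the current position turned by a right angle within the plane,
    and 0 in all other coordinates.\<close>
  let ?v = "\<chi> k. if k = i then - (?R t $ j) else if k = j then ?R t $ i else 0"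
  have "(?R has_vector_derivative ?v) (at t)"
    unfolding has_vector_derivative_def has_derivative_componentwise_within[of ?R]
    using \<open>i \<noteq> j\<close>
    by (auto simp: Basis_vec_def inner_axis plane_rotation_def algebra_simps intro!: derivative_eq_intros)
  from has_real_derivative_along_curve[OF p this]
  show ?thesis
    using \<open>i \<noteq> j\<close> sum.subset_diff[of "{i,j}" UNIV "\<lambda>k. ?v $ k * partial_deriv k p (?R t)"]
    by (simp add: angular_deriv_def)
qed

subsection \<open>Rotation invariance and orthogonality of spherical harmonics\<close>

text \<open>Lebesgue measure is determined by its values on boxes. The preimage of a box is its
  image under the inverse, which is again orthogonal and preserves volume; that fact concerns
  \<open>lebesgue\<close>, and the image is Borel, so it transfers to \<open>lborel\<close>.\<close>

lemma distr_lborel_orthogonal_transformation: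
  fixes T :: "real^'n::{finite,wellorder} \<Rightarrow> real^'n::_"
  assumes T: "orthogonal_transformation T"
  shows "distr lborel borel T = lborel"
proof (rule lborel_eqI[symmetric])
  have lin: "linear T" using T by (rule orthogonal_transformation_linear)
  have meas: "T \<in> borel_measurable borel"
    using lin by (intro borel_measurable_continuous_onI linear_continuous_on) (simp add: linear_conv_bounded_linear)
  define T' where "T' = inv T"
  have T': "orthogonal_transformation T'"
    unfolding T'_def using T by (rule orthogonal_transformation_inv)
  have vim: "T -` S = T' ` S" for S
    unfolding T'_def using orthogonal_transformation_bij[OF T] by (simp add: bij_vimage_eq_inv_image)
  show "emeasure (distr lborel borel T) (box l u) = ennreal (\<Prod>b\<in>Basis. (u - l) \<bullet> b)"
    if "\<And>b. b \<in> Basis \<Longrightarrow> l \<bullet> b \<le> u \<bullet> b" for l u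
  proof -
    have box: "box l u \<in> lmeasurable" by simp
    have "T' ` box l u \<in> sets borel"
      using measurable_sets[OF meas, of "box l u"] by (simp add: vim)
    then have "emeasure lborel (T' ` box l u) = emeasure lebesgue (T' ` box l u)"
      by simp
    also have "\<dots> = emeasure lebesgue (box l u)"
      using measure_orthogonal_image[OF T' box] measurable_orthogonal_image[OF T' box] box
      by (metis emeasure_eq_measure2)
    finally show ?thesis
      using that by (simp add: emeasure_distr meas vim)
  qed
qed simp

section \<open>The surface measure through cones, and its rotation invariance\<close>

lemma measurable_radial_projection:
  "(\<lambda>x. x /\<^sub>R norm x) \<in> measurable (restrict_space lborel (cball 0 1 - {0})) (restrict_space borel S2)"
proof (rule measurable_restrict_space2)
  have "(\<lambda>x::real^3. x /\<^sub>R norm x) \<in> borel_measurable borel"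
    by (intro borel_measurable_scaleR borel_measurable_inverse borel_measurable_norm) auto
  then show "(\<lambda>x. x /\<^sub>R norm x) \<in> restrict_space lborel (cball 0 1 - {0}) \<rightarrow>\<^sub>M borel"
    by (intro measurable_restrict_space1) simp
qed (auto simp: space_restrict_space S2_def)

lemma emeasure_surface_measure:
  assumes "A \<in> sets surface_measure"
  shows "emeasure surface_measure A = 3 * emeasure lborel {x\<in>cball 0 1 - {0}. x /\<^sub>R norm x \<in> A}"
proof -
  let ?M = "restrict_space lborel (cball (0::real^3) 1 - {0})"
  have "emeasure surface_measure A = 3 * emeasure ?M ((\<lambda>x. x /\<^sub>R norm x) -` A \<inter> space ?M)"
    using assms unfolding surface_measure_def
    by (simp only: emeasure_scale_measure sets_scale_measure sets_distr emeasure_distr[OF measurable_radial_projection])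
  also have "(\<lambda>x. x /\<^sub>R norm x) -` A \<inter> space ?M = {x\<in>cball 0 1 - {0}. x /\<^sub>R norm x \<in> A}"
    by (auto simp: space_restrict_space)
  also have "emeasure ?M \<dots> = emeasure lborel \<dots>"
    by (subst emeasure_restrict_space) auto
  finally show ?thesis .
qed

lemma finite_measure_surface_measure: "finite_measure surface_measure"
  by standard (simp add: space_surface_measure emeasure_surface_measure_S2)

lemma borel_measurable_surface_measureI:
  "continuous_on S2 f \<Longrightarrow> f \<in> borel_measurable surface_measure"
  using borel_measurable_continuous_on_restrict[of S2 f]
  by (simp add: measurable_cong_sets[OF sets_surface_measure refl])

lemma compact_S2: "compact S2"
  by (simp add: S2_def)

lemma bounded_on_S2:
  assumes "continuous_on S2 (f :: real^3 \<Rightarrow> real)"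
  obtains K where "\<And>x. x \<in> S2 \<Longrightarrow> \<bar>f x\<bar> \<le> K"
  using compact_imp_bounded[OF compact_continuous_image[OF assms compact_S2]]
  by (auto simp: bounded_iff)

lemma integrable_surface_measure:
  fixes f :: "real^3 \<Rightarrow> real"
  assumes f: "continuous_on S2 f"
  shows "integrable surface_measure f"
proof -
  interpret finite_measure surface_measure by (rule finite_measure_surface_measure)
  obtain K where "\<And>x. x \<in> S2 \<Longrightarrow> \<bar>f x\<bar> \<le> K" using bounded_on_S2[OF f] by blast
  then show ?thesis
    by (intro integrable_const_bound[where B = K] borel_measurable_surface_measureI f AE_I2)
       (auto simp: space_surface_measure)
qed

lemma measurable_orthogonal_transformation_surface_measure:
  assumes T: "orthogonal_transformation T"
  shows "T \<in> surface_measure \<rightarrow>\<^sub>M surface_measure"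
proof -
  have "T \<in> restrict_space borel S2 \<rightarrow>\<^sub>M restrict_space borel S2"
    using orthogonal_transformation_linear[OF T] orthogonal_transformation_norm[OF T]
    by (intro measurable_restrict_space2 measurable_restrict_space1
          borel_measurable_continuous_onI linear_continuous_on)
       (auto simp: space_restrict_space S2_def linear_conv_bounded_linear)
  then show ?thesis
    by (simp add: measurable_cong_sets[OF sets_surface_measure sets_surface_measure])
qed

text \<open>\<open>T\<close> is linear and preserves norms, so it commutes with radial projection:
  the cone over the preimage of \<open>A\<close> is the preimage of the cone over \<open>A\<close>.
  Invariance of Lebesgue measure finishes the argument.\<close>

lemma distr_surface_measure_orthogonal_transformation:
  assumes T: "orthogonal_transformation T"
  shows "distr surface_measure surface_measure T = surface_measure"
proof (rule measure_eqI)
  have norm: "norm (T x) = norm x" for x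
    using T by (rule orthogonal_transformation_norm)
  have lin: "linear T" using T by (rule orthogonal_transformation_linear)
  have Tmeas: "T \<in> borel_measurable borel"
    using lin by (intro borel_measurable_continuous_onI linear_continuous_on) (simp add: linear_conv_bounded_linear)
  have meas: "T \<in> surface_measure \<rightarrow>\<^sub>M surface_measure"
    using T by (rule measurable_orthogonal_transformation_surface_measure)
  fix A assume "A \<in> sets (distr surface_measure surface_measure T)"
  then have A: "A \<in> sets surface_measure" by simp
  let ?cone = "\<lambda>A. {x\<in>cball 0 1 - {0::real^3}. x /\<^sub>R norm x \<in> A}"
  have cone: "?cone A \<in> sets borel"
  proof -
    have "?cone A \<in> sets (restrict_space lborel (cball (0::real^3) 1 - {0}))"
      using measurable_sets[OF measurable_radial_projection, of A] A
      by (simp add: sets_surface_measure space_restrict_space vimage_def Int_def conj_commute)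
    then show ?thesis
      by (subst (asm) sets_restrict_space_iff) auto
  qed
  have "emeasure (distr surface_measure surface_measure T) A
      = emeasure surface_measure (T -` A \<inter> space surface_measure)"
    using meas A by (rule emeasure_distr)
  also have "\<dots> = 3 * emeasure lborel (?cone (T -` A \<inter> space surface_measure))"
    using measurable_sets[OF meas A] by (rule emeasure_surface_measure)
  also have "?cone (T -` A \<inter> space surface_measure) = T -` ?cone A"
  proof -
    have "T x = 0 \<longleftrightarrow> x = 0" for x using norm[of x] norm_eq_zero[of x] norm_eq_zero[of "T x"] by simp
    moreover have "T (x /\<^sub>R norm x) = T x /\<^sub>R norm (T x)" for x
      by (simp only: norm linear_cmul[OF lin])
    moreover have "x /\<^sub>R norm x \<in> S2" if "x \<noteq> 0" for x :: "real^3"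
      using that by (simp add: S2_def)
    ultimately show ?thesis
      unfolding space_surface_measure by (auto simp only: vimage_def Int_iff mem_Collect_eq Diff_iff mem_cball_0 norm singleton_iff)
  qed
  also have "emeasure lborel (T -` ?cone A) = emeasure lborel (?cone A)"
    using arg_cong[OF distr_lborel_orthogonal_transformation[OF T], of "\<lambda>M. emeasure M (?cone A)"] cone Tmeas
    by (simp add: emeasure_distr)
  also have "3 * \<dots> = emeasure surface_measure A"
    using A by (rule emeasure_surface_measure[symmetric])
  finally show "emeasure (distr surface_measure surface_measure T) A = emeasure surface_measure A" .
qed simp

lemma integral_surface_measure_orthogonal_transformation:
  fixes f :: "real^3 \<Rightarrow> real"
  assumes T: "orthogonal_transformation T" and f: "continuous_on S2 f"
  shows "(\<integral>x. f (T x) \<partial>surface_measure) = (\<integral>x. f x \<partial>surface_measure)"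
  using integral_distr[OF measurable_orthogonal_transformation_surface_measure[OF T]
      borel_measurable_surface_measureI[OF f]]
  by (simp add: distr_surface_measure_orthogonal_transformation[OF T])

section \<open>Integration by parts on the sphere and orthogonality of different degrees\<close>

lemma continuous_on_real_polynomial_function:
  "real_polynomial_function p \<Longrightarrow> continuous_on S p"
  by (simp add: continuous_on_polymonial_function real_polynomial_function_eq)

text \<open>The integral of \<open>p\<close> over the sphere does not change when \<open>p\<close> is rotated; differentiate
  in the angle.\<close>

lemma integral_angular_deriv_eq_0:
  assumes p: "real_polynomial_function p" and ij: "i \<noteq> j"
  shows "(\<integral>x. angular_deriv i j p x \<partial>surface_measure) = 0"
proof -
  \<comment> \<open>Difference quotients in the angle along 1/(n + 1), a sequence tending to 0 so
    that dominated convergence applies.\<close>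
  define s where "s n x = (p (plane_rotation i j (inverse (real (Suc n))) x) - p x) / inverse (real (Suc n))" for n x
  let ?L = "angular_deriv i j p"
  have cont_rot: "continuous_on S2 (\<lambda>x. p (plane_rotation i j t x))" for t
    using linear_continuous_on[of "plane_rotation i j t" S2]
      orthogonal_transformation_linear[OF orthogonal_transformation_plane_rotation[OF ij, of t]]
    by (intro continuous_on_compose2[OF continuous_on_real_polynomial_function[OF p, of UNIV]])
       (auto simp: linear_conv_bounded_linear)
  have contL: "continuous_on S2 ?L"
    using p by (intro continuous_on_real_polynomial_function) auto
  obtain K where K: "\<And>x. x \<in> S2 \<Longrightarrow> \<bar>?L x\<bar> \<le> K" using bounded_on_S2[OF contL] by blast
  have lim: "(\<lambda>n. s n x) \<longlonglongrightarrow> ?L x" for x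
  proof -
    have "((\<lambda>t. (p (plane_rotation i j t x) - p x) / t) \<longlongrightarrow> ?L x) (at 0)"
      using has_real_derivative_plane_rotation[OF p ij, of x 0] by (simp add: DERIV_def)
    from filterlim_compose[OF this, of "\<lambda>n. inverse (real (Suc n))" sequentially]
    show ?thesis
      unfolding s_def using LIMSEQ_inverse_real_of_nat by (auto simp: filterlim_at simp del: of_nat_Suc)
  qed
  \<comment> \<open>By the mean value theorem each quotient is a value of the angular derivative at
    a rotated point, which is still on the sphere; hence the one constant \<open>K\<close> dominates
    all of them.\<close>
  have bound: "\<bar>s n x\<bar> \<le> K" if "x \<in> S2" for n x
  proof -
    let ?t = "inverse (real (Suc n))"
    have "\<exists>z>0. z < ?t \<and> p (plane_rotation i j ?t x) - p (plane_rotation i j 0 x)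
        = (?t - 0) * ?L (plane_rotation i j z x)"
      by (rule MVT2) (auto intro: has_real_derivative_plane_rotation[OF p ij])
    then obtain z where "p (plane_rotation i j ?t x) - p x = ?t * ?L (plane_rotation i j z x)"
      by auto
    then have "s n x = ?L (plane_rotation i j z x)"
      by (simp add: s_def del: of_nat_Suc)
    moreover have "plane_rotation i j z x \<in> S2"
      using that orthogonal_transformation_norm[OF orthogonal_transformation_plane_rotation[OF ij]]
      by (simp add: S2_def)
    ultimately show ?thesis using K by simp
  qed
  have "(\<lambda>n. \<integral>x. s n x \<partial>surface_measure) \<longlonglongrightarrow> (\<integral>x. ?L x \<partial>surface_measure)"
  proof (rule integral_dominated_convergence[where w = "\<lambda>_. K"])
    show "?L \<in> borel_measurable surface_measure"
      using contL by (rule borel_measurable_surface_measureI)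
    show "s n \<in> borel_measurable surface_measure" for n
      unfolding s_def
      by (intro borel_measurable_surface_measureI continuous_intros cont_rot
            continuous_on_real_polynomial_function p) auto
    show "integrable surface_measure (\<lambda>_. K)"
      by (intro integrable_surface_measure continuous_on_const)
  qed (auto simp: lim bound space_surface_measure)
  \<comment> \<open>Rotation invariance: both terms of the quotient have the same integral.\<close>
  moreover have "(\<integral>x. s n x \<partial>surface_measure) = 0" for n
    unfolding s_def
    by (simp add: Bochner_Integration.integral_diff integrable_surface_measure cont_rot
        continuous_on_real_polynomial_function p
        integral_surface_measure_orthogonal_transformation
          [OF orthogonal_transformation_plane_rotation[OF ij] continuous_on_real_polynomial_function[OF p]]
        del: of_nat_Suc)
  ultimately show ?thesis
    using LIMSEQ_unique[OF _ tendsto_const[of 0 sequentially]] by simp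
qed

text \<open>The product rule, together with the vanishing integral of the angular derivative of
  \<open>p x * q x\<close>.\<close>

lemma integral_angular_deriv_by_parts:
  assumes p: "real_polynomial_function p" and q: "real_polynomial_function q" and ij: "i \<noteq> j"
  shows "(\<integral>x. angular_deriv i j p x * q x \<partial>surface_measure)
    = - (\<integral>x. p x * angular_deriv i j q x \<partial>surface_measure)"
proof -
  have "integrable surface_measure (\<lambda>x. angular_deriv i j p x * q x)"
    "integrable surface_measure (\<lambda>x. p x * angular_deriv i j q x)"
    using p q by (auto intro!: integrable_surface_measure continuous_on_real_polynomial_function)
  then show ?thesis
    using integral_angular_deriv_eq_0[OF real_polynomial_function.intros(4)[OF p q] ij]
    by (simp add: angular_deriv_mult[OF p q])
qed

text \<open>Integrate the eigenvalue equation of \<open>p\<close> against \<open>q\<close> and move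
  one angular derivative onto \<open>q\<close>. The point is that the right-hand side is symmetric
  in \<open>p\<close> and \<open>q\<close>.\<close>

lemma integral_harmonic_mult_harmonic:
  assumes hp: "harmonic_homogeneous_poly l p" and q: "real_polynomial_function q"
  shows "real l * (real l + 1) * (\<integral>x. p x * q x \<partial>surface_measure) =
    (\<integral>x. angular_deriv 1 2 p x * angular_deriv 1 2 q x \<partial>surface_measure) +
    (\<integral>x. angular_deriv 1 3 p x * angular_deriv 1 3 q x \<partial>surface_measure) +
    (\<integral>x. angular_deriv 2 3 p x * angular_deriv 2 3 q x \<partial>surface_measure)"
proof -
  have p: "real_polynomial_function p" using hp by (simp add: harmonic_homogeneous_poly_def)
  let ?I = "\<lambda>i j. \<integral>x. angular_deriv i j (angular_deriv i j p) x * q x \<partial>surface_measure"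
  have int: "integrable surface_measure (\<lambda>x. angular_deriv i j (angular_deriv i j p) x * q x)" for i j
    using p q by (auto intro!: integrable_surface_measure continuous_on_real_polynomial_function)
  have "- (real l * (real l + 1)) * (\<integral>x. p x * q x \<partial>surface_measure)
      = (\<integral>x. (- (real l * (real l + 1)) * p x) * q x \<partial>surface_measure)"
    by (simp only: mult.assoc integral_mult_right_zero)
  also have "\<dots> = ?I 1 2 + ?I 1 3 + ?I 2 3"
    unfolding angular_deriv_casimir[OF hp, symmetric]
    using int by (simp add: ring_distribs)
  also have "\<dots> = - ((\<integral>x. angular_deriv 1 2 p x * angular_deriv 1 2 q x \<partial>surface_measure) +
    (\<integral>x. angular_deriv 1 3 p x * angular_deriv 1 3 q x \<partial>surface_measure) +
    (\<integral>x. angular_deriv 2 3 p x * angular_deriv 2 3 q x \<partial>surface_measure))"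
    using p q by (simp add: integral_angular_deriv_by_parts real_polynomial_function_angular_deriv)
  finally show ?thesis by simp
qed

lemma L2_inner_cong:
  "(\<And>x. x \<in> S2 \<Longrightarrow> f x = f' x) \<Longrightarrow> (\<And>x. x \<in> S2 \<Longrightarrow> g x = g' x) \<Longrightarrow> L2_inner f g = L2_inner f' g'"
  unfolding L2_inner_def by (intro Bochner_Integration.integral_cong) (auto simp: space_surface_measure)

text \<open>The symmetry in \<open>integral_harmonic_mult_harmonic\<close> gives the same inner
  product with the two factors l(l + 1) and m(m + 1), which differ.\<close>

lemma spherical_harmonics_orthogonal:
  assumes f: "f \<in> spherical_harmonics l" and g: "g \<in> spherical_harmonics m" and "l \<noteq> m"
  shows "L2_inner f g = 0"
proof -
  obtain p q where p: "harmonic_homogeneous_poly l p" "\<And>x. x \<in> S2 \<Longrightarrow> f x = p x"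
    and q: "harmonic_homogeneous_poly m q" "\<And>x. x \<in> S2 \<Longrightarrow> g x = q x"
    using f g by (auto simp: spherical_harmonics_def)
  have poly: "real_polynomial_function p" "real_polynomial_function q"
    using p q by (auto simp: harmonic_homogeneous_poly_def)
  have "real l * (real l + 1) * L2_inner p q = real m * (real m + 1) * L2_inner q p"
    using integral_harmonic_mult_harmonic[OF p(1) poly(2)] integral_harmonic_mult_harmonic[OF q(1) poly(1)]
    by (simp add: L2_inner_def mult.commute)
  moreover have "L2_inner q p = L2_inner p q"
    by (simp add: L2_inner_def mult.commute)
  moreover have "real l * (real l + 1) \<noteq> real m * (real m + 1)"
  proof -
    have "real l * (real l + 1) - real m * (real m + 1) = (real l - real m) * (real l + real m + 1)"
      by (simp add: algebra_simps)
    then show ?thesis using \<open>l \<noteq> m\<close> by auto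
  qed
  ultimately have "L2_inner p q = 0" by simp
  moreover have "L2_inner f g = L2_inner p q"
    using p(2) q(2) by (rule L2_inner_cong)
  ultimately show ?thesis by simp
qed

subsection \<open>Hyperinterpolation\<close>

lemma spherical_harmonics_continuous_on:
  assumes "f \<in> spherical_harmonics l"
  shows "continuous_on S2 f"
proof -
  obtain p where "real_polynomial_function p" "\<forall>x\<in>S2. f x = p x"
    using assms by (auto simp: spherical_harmonics_def harmonic_homogeneous_poly_def)
  then show ?thesis
    by (metis continuous_on_cong continuous_on_real_polynomial_function)
qed

lemma harmonic_homogeneous_poly_zero: "harmonic_homogeneous_poly l (\<lambda>x. 0)"
  unfolding harmonic_homogeneous_poly_def
  by (simp add: laplacian_eq_sum_partial_deriv real_polynomial_function.intros(2))

text \<open>Shaped as the induction step of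
  \<open>spherical_harmonics_linear_combination\<close>.\<close>

lemma harmonic_homogeneous_poly_add_cmult:
  assumes "harmonic_homogeneous_poly l p" "harmonic_homogeneous_poly l q"
  shows "harmonic_homogeneous_poly l (\<lambda>x. c * p x + q x)"
proof -
  have p: "real_polynomial_function p" and q: "real_polynomial_function q"
    using assms by (auto simp: harmonic_homogeneous_poly_def)
  have r: "real_polynomial_function (\<lambda>x. c * p x + q x)"
    using p q by (intro real_polynomial_function.intros(2-4))
  have cp: "real_polynomial_function (\<lambda>x. c * p x)" if "real_polynomial_function p" for p :: "real^3 \<Rightarrow> real"
    using that by (intro real_polynomial_function.intros(2-4))
  \<comment> \<open>Quantified over the polynomials, since the Laplacian requires it for
    \<open>p\<close>, \<open>q\<close> and again for their partial derivatives.\<close>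
  have lin: "partial_deriv i (\<lambda>x. c * p x + q x) = (\<lambda>x. c * partial_deriv i p x + partial_deriv i q x)"
    if "real_polynomial_function p" "real_polynomial_function q" for i and p q :: "real^3 \<Rightarrow> real"
    using that cp[OF that(1)]
    by (intro ext) (simp add: partial_deriv_add partial_deriv_mult differentiable_at_real_polynomial_function)
  have "laplacian (\<lambda>x. c * p x + q x) x = c * laplacian p x + laplacian q x" for x
    using p q r by (simp add: laplacian_eq_sum_partial_deriv lin real_polynomial_function_partial_deriv
        sum.distrib sum_distrib_left)
  with assms r show ?thesis
    by (simp add: harmonic_homogeneous_poly_def algebra_simps)
qed

lemma spherical_harmonics_linear_combination:
  assumes "finite K" "\<And>k. k \<in> K \<Longrightarrow> f k \<in> spherical_harmonics l"
  shows "(\<lambda>x. \<Sum>k\<in>K. c k * f k x) \<in> spherical_harmonics l"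
  using assms
proof (induction K)
  case empty
  then show ?case
    using harmonic_homogeneous_poly_zero by (auto simp: spherical_harmonics_def)
next
  case (insert k K)
  then have "f k \<in> spherical_harmonics l" "(\<lambda>x. \<Sum>k\<in>K. c k * f k x) \<in> spherical_harmonics l"
    by simp_all
  then obtain p q where "harmonic_homogeneous_poly l p" "\<forall>x\<in>S2. f k x = p x"
    "harmonic_homogeneous_poly l q" "\<forall>x\<in>S2. (\<Sum>k\<in>K. c k * f k x) = q x"
    unfolding spherical_harmonics_def by blast
  then show ?case
    using insert.hyps harmonic_homogeneous_poly_add_cmult[of l p q "c k"]
    by (auto simp: spherical_harmonics_def)
qed

lemma L2_inner_orthonormal_sums:
  assumes "finite I" and cont: "\<And>a. a \<in> I \<Longrightarrow> continuous_on S2 (y a)"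
    and ortho: "\<And>a b. a \<in> I \<Longrightarrow> b \<in> I \<Longrightarrow> L2_inner (y a) (y b) = (if a = b then 1 else 0)"
  shows "L2_inner (\<lambda>x. \<Sum>a\<in>I. c a * y a x) (\<lambda>x. \<Sum>a\<in>I. d a * y a x) = (\<Sum>a\<in>I. c a * d a)"
proof -
  have int: "integrable surface_measure (\<lambda>x. c a * d b * (y a x * y b x))" if "a \<in> I" "b \<in> I" for a b
    using that by (intro integrable_surface_measure continuous_intros cont)
  have "L2_inner (\<lambda>x. \<Sum>a\<in>I. c a * y a x) (\<lambda>x. \<Sum>a\<in>I. d a * y a x)
      = (\<integral>x. (\<Sum>a\<in>I. \<Sum>b\<in>I. c a * d b * (y a x * y b x)) \<partial>surface_measure)"
    by (simp add: L2_inner_def sum_product mult_ac)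
  also have "\<dots> = (\<Sum>a\<in>I. \<Sum>b\<in>I. c a * d b * L2_inner (y a) (y b))"
    using int by (simp add: L2_inner_def)
  also have "\<dots> = (\<Sum>a\<in>I. \<Sum>b\<in>I. if a = b then c a * d b else 0)"
    by (intro sum.cong refl) (simp add: ortho)
  also have "\<dots> = (\<Sum>a\<in>I. c a * d a)"
    using \<open>finite I\<close> by simp
  finally show ?thesis .
qed

text \<open>\<open>sup_norm\<close> is a supremum of reals, so it bounds the values only once
  compactness of the sphere has made them bounded.\<close>

lemma abs_le_sup_norm:
  assumes "f \<in> C_S2" "x \<in> S2"
  shows "\<bar>f x\<bar> \<le> sup_norm f"
proof -
  obtain K where "\<And>x. x \<in> S2 \<Longrightarrow> \<bar>f x\<bar> \<le> K"
    using assms bounded_on_S2[of f] by (auto simp: C_S2_def)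
  then have "bdd_above ((\<lambda>x. \<bar>f x\<bar>) ` S2)" by (rule bdd_aboveI2)
  then show ?thesis unfolding sup_norm_def using assms by (intro cSUP_upper)
qed

text \<open>Any function on a finite set is continuous and the set is closed in the sphere, so
  Tietze's theorem extends it with values in [-1, 1].\<close>

lemma continuous_interpolation_S2:
  assumes X: "finite X" "X \<subseteq> S2" and s: "\<And>x. x \<in> X \<Longrightarrow> \<bar>s x\<bar> \<le> 1"
  obtains f where "f \<in> C_S2" "sup_norm f \<le> 1" "\<And>x. x \<in> X \<Longrightarrow> f x = s x"
proof -
  have "axis 1 1 \<in> S2" by (simp add: S2_def)
  then have ne: "S2 \<noteq> {}" by blast
  have "continuous_on X s" using X(1) by (rule continuous_on_finite)
  moreover have "closedin (top_of_set S2) X"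
    using X by (simp add: closed_subset finite_imp_closed)
  ultimately obtain f where f: "continuous_on S2 f" "\<And>x. x \<in> X \<Longrightarrow> f x = s x"
      "\<And>x. x \<in> S2 \<Longrightarrow> f x \<in> cbox (- 1) 1"
    using s by (auto intro: Tietze_closed_interval_1[of X s S2 "- 1" 1] simp: abs_le_iff minus_le_iff)
  then have "sup_norm f \<le> 1"
    unfolding sup_norm_def using ne by (intro cSUP_least) (auto simp: abs_le_iff minus_le_iff)
  with f show thesis by (intro that[of f]) (auto simp: C_S2_def)
qed

section \<open>The joint orthonormal basis of all degrees up to n\<close>

locale harmonic_basis =
  fixes Y :: "nat \<Rightarrow> int \<Rightarrow> real^3 \<Rightarrow> real" and n :: nat
  assumes orthonormal: "\<And>l. orthonormal_basis_harmonics l (Y l)"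
begin

text \<open>Flattening the double index turns L2 inner products into Euclidean ones over a single
  finite set.\<close>

definition I :: "(nat \<times> int) set" where
  "I = (SIGMA l:{..n}. {-int l..int l})"

definition y :: "nat \<times> int \<Rightarrow> real^3 \<Rightarrow> real" where
  "y a = Y (fst a) (snd a)"

definition combination :: "(nat \<times> int \<Rightarrow> real) \<Rightarrow> real^3 \<Rightarrow> real" where
  "combination c x = (\<Sum>a\<in>I. c a * y a x)"

lemma finite_I: "finite I"
  by (simp add: I_def)

lemma sum_I: "(\<Sum>a\<in>I. g (fst a) (snd a)) = (\<Sum>l\<le>n. \<Sum>k=-int l..int l. g l k)"
  by (simp add: I_def sum.Sigma split_beta)

lemma y_spherical_harmonics: "a \<in> I \<Longrightarrow> y a \<in> spherical_harmonics (fst a)"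
  using orthonormal by (auto simp: I_def y_def orthonormal_basis_harmonics_def)

text \<open>Within one degree this is the assumption on \<open>Y\<close>; across degrees it is
  \<open>spherical_harmonics_orthogonal\<close>.\<close>

lemma L2_inner_y:
  assumes "a \<in> I" "b \<in> I"
  shows "L2_inner (y a) (y b) = (if a = b then 1 else 0)"
proof (cases "fst a = fst b")
  case True
  then show ?thesis
    using assms orthonormal[of "fst b"]
    by (auto simp: I_def y_def orthonormal_basis_harmonics_def prod_eq_iff)
next
  case False
  then show ?thesis
    using spherical_harmonics_orthogonal[OF y_spherical_harmonics y_spherical_harmonics] assms by auto
qed

lemma L2_inner_combination: "L2_inner (combination c) (combination d) = (\<Sum>a\<in>I. c a * d a)"
  unfolding combination_def[abs_def]
  by (intro L2_inner_orthonormal_sums finite_I L2_inner_y)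
     (auto intro: spherical_harmonics_continuous_on y_spherical_harmonics)

text \<open>Parseval's identity, which lets the final argument work with coefficient
  vectors.\<close>

lemma L2_norm_combination: "L2_norm (combination c) = L2_set c I"
  by (simp add: L2_norm_def L2_inner_combination L2_set_def power2_eq_square)

lemma combination_in_sphere_polys: "combination c \<in> sphere_polys n"
proof -
  have "(\<lambda>x. \<Sum>k=-int l..int l. c (l, k) * Y l k x) \<in> spherical_harmonics l" for l
    using orthonormal[of l]
    by (intro spherical_harmonics_linear_combination) (auto simp: orthonormal_basis_harmonics_def)
  moreover have "combination c x = (\<Sum>l\<le>n. \<Sum>k=-int l..int l. c (l, k) * Y l k x)" for x
    using sum_I[of "\<lambda>l k. c (l, k) * Y l k x"] by (simp add: combination_def y_def)
  ultimately show ?thesis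
    unfolding sphere_polys_def
    by (intro CollectI exI[of _ "\<lambda>l x. \<Sum>k=-int l..int l. c (l, k) * Y l k x"]) simp
qed

lemma sphere_polys_eq_combination:
  assumes "p \<in> sphere_polys n"
  obtains c where "\<And>x. x \<in> S2 \<Longrightarrow> p x = combination c x"
proof -
  obtain h where h: "\<And>l. l \<le> n \<Longrightarrow> h l \<in> spherical_harmonics l"
    and p: "\<And>x. x \<in> S2 \<Longrightarrow> p x = (\<Sum>l\<le>n. h l x)"
    using assms by (auto simp: sphere_polys_def)
  \<comment> \<open>The condition \<open>l \<le> n\<close> sits inside the existential so that
    coefficients can be chosen for all \<open>l\<close> at once.\<close>
  have "\<forall>l. \<exists>c. l \<le> n \<longrightarrow> (\<forall>x\<in>S2. h l x = (\<Sum>k=-int l..int l. c k * Y l k x))"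
    using h orthonormal unfolding orthonormal_basis_harmonics_def by blast
  then obtain c where c: "\<And>l x. l \<le> n \<Longrightarrow> x \<in> S2 \<Longrightarrow> h l x = (\<Sum>k=-int l..int l. c l k * Y l k x)"
    by metis
  have "p x = combination (\<lambda>a. c (fst a) (snd a)) x" if "x \<in> S2" for x
    using sum_I[of "\<lambda>l k. c l k * Y l k x"] that by (simp add: p c combination_def y_def)
  then show thesis by (rule that)
qed

lemma hyperinterpolation_eq_combination:
  "hyperinterpolation Y n Q f = combination (\<lambda>a. Q (\<lambda>x. f x * y a x))"
  using sum_I[of "\<lambda>l k. Q (\<lambda>x. f x * Y l k x) * Y l k _"]
  by (auto simp: hyperinterpolation_def combination_def y_def fun_eq_iff)

text \<open>The defining property \<open>\<langle>L f, p\<rangle> = Q (f p)\<close> of hyperinterpolation, with \<open>p\<close> given by its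
  coefficients \<open>c\<close>.\<close>

lemma quadrature_mult_combination:
  "(\<Sum>a\<in>I. quadrature N w x (\<lambda>z. f z * y a z) * c a) = quadrature N w x (\<lambda>z. f z * combination c z)"
proof -
  have "(\<Sum>a\<in>I. quadrature N w x (\<lambda>z. f z * y a z) * c a)
      = (\<Sum>a\<in>I. \<Sum>j=1..N. w j * (f (x j) * (c a * y a (x j))))"
    by (simp add: quadrature_def sum_distrib_left mult_ac)
  also have "\<dots> = quadrature N w x (\<lambda>z. f z * combination c z)"
    by (subst sum.swap) (simp add: quadrature_def combination_def sum_distrib_left mult_ac)
  finally show ?thesis .
qed

end

theorem theorem5p3:
  fixes Y :: "nat \<Rightarrow> int \<Rightarrow> real^3 \<Rightarrow> real"
    and N n :: nat
    and w :: "nat \<Rightarrow> real"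
    and x :: "nat \<Rightarrow> real^3"
    and C :: real
  assumes "\<And>l. orthonormal_basis_harmonics l (Y l)"
    and "quadrature_data N x"
    and "C > 0"
  shows "(\<forall>p\<in>sphere_polys n. (\<Sum>j=1..N. \<bar>w j\<bar> * \<bar>p (x j)\<bar>) \<le> C * L2_norm p)
     \<longleftrightarrow> op_norm_C_L2 (hyperinterpolation Y n (quadrature N w x)) \<le> ereal C"
proof
  let ?MZ = "\<forall>p\<in>sphere_polys n. (\<Sum>j=1..N. \<bar>w j\<bar> * \<bar>p (x j)\<bar>) \<le> C * L2_norm p"
  let ?L = "hyperinterpolation Y n (quadrature N w x)"
  interpret harmonic_basis Y n by standard (rule assms(1))
  have xS2: "x j \<in> S2" if "j \<in> {1..N}" for j
    using assms(2) that by (auto simp: quadrature_data_def)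
  have inj: "inj_on x {1..N}" using assms(2) by (simp add: quadrature_data_def)
  define coeff where "coeff f a = quadrature N w x (\<lambda>z. f z * y a z)" for f a
  have L: "?L f = combination (coeff f)" for f
    by (simp add: hyperinterpolation_eq_combination coeff_def[abs_def])
  \<comment> \<open>The identity \<langle>L f, p\<rangle> = Q(f p) in coordinates, used below with
    \<open>c = coeff f\<close> and with the coefficients of a given \<open>p\<close>.\<close>
  have Q: "(\<Sum>a\<in>I. coeff f a * c a) = (\<Sum>j=1..N. w j * (f (x j) * combination c (x j)))" for f c
    using quadrature_mult_combination[of N w x f c] by (simp add: coeff_def quadrature_def)
  show "op_norm_C_L2 ?L \<le> ereal C" if ?MZ
    unfolding op_norm_C_L2_def
  proof (rule SUP_least)
    fix f assume "f \<in> {f \<in> C_S2. sup_norm f \<le> 1}"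
    then have f: "\<bar>f (x j)\<bar> \<le> 1" if "j \<in> {1..N}" for j
      using abs_le_sup_norm[of f "x j"] xS2[OF that] by simp
    \<comment> \<open>Testing with \<open>p = L f\<close> itself: the squared norm becomes Q(f L f),
      to which the Marcinkiewicz--Zygmund condition applies.\<close>
    have "(L2_norm (?L f))\<^sup>2 = (\<Sum>a\<in>I. coeff f a * coeff f a)"
      by (simp add: L L2_norm_combination L2_set_def sum_nonneg power2_eq_square)
    also have "\<dots> = (\<Sum>j=1..N. w j * (f (x j) * ?L f (x j)))"
      by (simp add: Q L)
    also have "\<dots> \<le> (\<Sum>j=1..N. \<bar>w j\<bar> * \<bar>?L f (x j)\<bar>)"
    proof (rule sum_mono)
      fix j assume j: "j \<in> {1..N}"
      have "w j * (f (x j) * ?L f (x j)) \<le> \<bar>f (x j)\<bar> * (\<bar>w j\<bar> * \<bar>?L f (x j)\<bar>)"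
        by (rule order_trans[OF abs_ge_self]) (simp add: abs_mult mult_ac)
      also have "\<dots> \<le> 1 * (\<bar>w j\<bar> * \<bar>?L f (x j)\<bar>)"
        by (intro mult_right_mono f j) simp
      finally show "w j * (f (x j) * ?L f (x j)) \<le> \<bar>w j\<bar> * \<bar>?L f (x j)\<bar>" by simp
    qed
    also have "\<dots> \<le> C * L2_norm (?L f)"
      using that combination_in_sphere_polys[of "coeff f"] by (simp add: L)
    finally have "L2_norm (?L f) * L2_norm (?L f) \<le> C * L2_norm (?L f)"
      by (simp add: power2_eq_square)
    moreover have "L2_norm (?L f) \<ge> 0" by (simp add: L L2_norm_combination)
    \<comment> \<open>Cancel one factor of the norm if it is positive; if it is 0, the bound is just
      \<open>C > 0\<close>.\<close>
    ultimately have "L2_norm (?L f) \<le> C"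
      using \<open>C > 0\<close> mult_right_le_imp_le[of "L2_norm (?L f)" "L2_norm (?L f)" C] by fastforce
    then show "ereal (L2_norm (?L f)) \<le> ereal C" by simp
  qed
  show ?MZ if norm_le: "op_norm_C_L2 ?L \<le> ereal C"
  proof
    fix p assume "p \<in> sphere_polys n"
    then obtain c where c: "\<And>x. x \<in> S2 \<Longrightarrow> p x = combination c x"
      using sphere_polys_eq_combination by blast
    have norm_p: "L2_norm p = L2_set c I"
      using L2_inner_cong[OF c c] by (simp add: L2_norm_def flip: L2_norm_combination)
    \<comment> \<open>The sign must be a function of the point, not of the index. Since the nodes
      are distinct, \<open>the_inv_into\<close> recovers the index and hence the weight.\<close>
    define s where "s z = sgn (w (the_inv_into {1..N} x z) * p z)" for z
    obtain f where f: "f \<in> C_S2" "sup_norm f \<le> 1" "\<And>z. z \<in> x ` {1..N} \<Longrightarrow> f z = s z"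
      by (rule continuous_interpolation_S2[of "x ` {1..N}" s]) (use xS2 in \<open>auto simp: s_def abs_sgn_eq\<close>)
    have fx: "f (x j) = sgn (w j * p (x j))" if "j \<in> {1..N}" for j
      using f(3)[of "x j"] that the_inv_into_f_f[OF inj that] by (simp add: s_def)
    have "(\<Sum>j=1..N. \<bar>w j\<bar> * \<bar>p (x j)\<bar>) = (\<Sum>j=1..N. w j * (f (x j) * combination c (x j)))"
    proof (rule sum.cong)
      fix j assume j: "j \<in> {1..N}"
      have "w j * (f (x j) * combination c (x j)) = (w j * p (x j)) * sgn (w j * p (x j))"
        using c[OF xS2[OF j]] by (simp add: fx[OF j] mult_ac)
      also have "\<dots> = \<bar>w j\<bar> * \<bar>p (x j)\<bar>"
        by (simp only: abs_mult flip: abs_sgn)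
      finally show "\<bar>w j\<bar> * \<bar>p (x j)\<bar> = w j * (f (x j) * combination c (x j))" by simp
    qed simp
    also have "\<dots> = (\<Sum>a\<in>I. coeff f a * c a)" by (simp add: Q)
    \<comment> \<open>Passing to absolute values puts the sum in the form required by the
      Cauchy--Schwarz inequality \<open>L2_set_mult_ineq\<close>.\<close>
    also have "\<dots> \<le> (\<Sum>a\<in>I. \<bar>coeff f a\<bar> * \<bar>c a\<bar>)"
      by (intro sum_mono) (metis abs_ge_self abs_mult)
    also have "\<dots> \<le> L2_set (coeff f) I * L2_set c I"
      by (rule L2_set_mult_ineq)
    also have "\<dots> \<le> C * L2_set c I"
    proof (rule mult_right_mono)
      \<comment> \<open>The interpolant \<open>f\<close> is admissible in the supremum, and by
        Parseval the norm of \<open>L f\<close> is that of its coefficients.\<close>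
      have "ereal (L2_norm (?L f)) \<le> op_norm_C_L2 ?L"
        unfolding op_norm_C_L2_def using f by (intro SUP_upper) auto
      also note norm_le
      finally show "L2_set (coeff f) I \<le> C" by (simp add: L L2_norm_combination)
    qed simp
    finally show "(\<Sum>j=1..N. \<bar>w j\<bar> * \<bar>p (x j)\<bar>) \<le> C * L2_norm p"
      by (simp add: norm_p)
  qed
qed

end
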